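(* Let $V$ be a finite set with $|V|\ge2$, let $m\ge 1$ be an integer, and let $\mathbf r=(r(x,k)\colon x\in V,\ k\in\mathbb N)$ be a collection of positive numbers, with the convention $r(x,0)=0$ for all $x\in V$. For any irreducible doubly stochastic matrix $P$ on $V$, $$\lambda\bigl(\mathrm{zrp}(P,\mathbf r,m)\bigr)\ \ge\ \lambda(P)\,\inf_{x\in V,\ k\in\mathbb Z_+}\bigl\{r(x,k+1)-r(x,k)\bigr\}.$$
   Context: $\mathbb N=\{1,2,\dots\}$, $\mathbb Z_+=\{0,1,2,\dots\}$. The state space is $\Omega=\{\eta\in\mathbb Z_+^V\colon \sum_{x\in V}\eta(x)=m\}$; $(\delta_x)_{x\in V}$ is the canonical basis of $\mathbb R^V$. Let $\pi$ be the invariant law of $P$ (here uniform on $V$, since $P$ is doubly stochastic). The zero-range process $\mathrm{zrp}(P,\mathbf r,m)$ is the continuous-time Markov chain on $\Omega$ with generator $$(\mathcal L f)(\eta)=\sum_{(x,y)\in V^2} r(x,\eta(x))\,P(x,y)\,\bigl(f(\eta+\delta_y-\delta_x)-f(\eta)\bigr)$$ (terms with $\eta(x)=0$ being zero). Its stationary law is $$\mu(\eta)=\frac1Z\prod_{x\in V}\prod_{k=1}^{\eta(x)}\frac{\pi(x)}{r(x,k)},$$ with $Z$ the normalization constant. Its Dirichlet form is $\mathcal E_{\mathrm{zrp}(P,\mathbf r,m)}(f,g)=-\sum_{\eta\in\Omega}\mu(\eta)f(\eta)(\mathcal L g)(\eta)$, and its Poincaré constant is $\lambda(\mathrm{zrp}(P,\mathbf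 r,m))=\min_f \mathcal E_{\mathrm{zrp}(P,\mathbf r,m)}(f,f)/\mathrm{Var}_\mu(f)$, over non-constant $f\colon\Omega\to\mathbb R$. The Dirichlet form of $P$ is $\mathcal E_P(\phi,\psi)=\sum_{x\in V}\pi(x)\phi(x)((I-P)\psi)(x)$, and the Poincaré constant of $P$ is $\lambda(P)=\min_\phi \mathcal E_P(\phi,\phi)/\mathrm{Var}_\pi(\phi)$, over non-constant $\phi\colon V\to\mathbb R$. No reversibility is assumed. *)

theory Defs
  imports "HOL-Analysis.Analysis"
begin

definition doubly_stochastic :: "real^'v^'v \<Rightarrow> bool" where
  "doubly_stochastic P \<longleftrightarrow>
     (\<forall>x y. 0 \<le> P $ x $ y) \<and>
     (\<forall>x. (\<Sum>y\<in>UNIV. P $ x $ y) = 1) \<and>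
     (\<forall>y. (\<Sum>x\<in>UNIV. P $ x $ y) = 1)"

definition matrix_power :: "real^'v^'v \<Rightarrow> nat \<Rightarrow> real^'v^'v" where
  "matrix_power P n = (((**) P) ^^ n) (mat 1)"

definition irreducible_matrix :: "real^'v^'v \<Rightarrow> bool" where
  "irreducible_matrix P \<longleftrightarrow> (\<forall>x y. \<exists>n. 0 < matrix_power P n $ x $ y)"

definition is_invariant_law :: "real^'v^'v \<Rightarrow> real^'v \<Rightarrow> bool" where
  "is_invariant_law P p \<longleftrightarrow>
     (\<forall>x. 0 \<le> p $ x) \<and> (\<Sum>x\<in>UNIV. p $ x) = 1 \<and> p v* P = p"

definition invariant_law :: "real^'v^'v \<Rightarrow> real^'v" where
  "invariant_law P = (THE p. is_invariant_law P p)"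

definition expectation_on :: "'a set \<Rightarrow> ('a \<Rightarrow> real) \<Rightarrow> ('a \<Rightarrow> real) \<Rightarrow> real" where
  "expectation_on S \<mu> f = (\<Sum>s\<in>S. \<mu> s * f s)"

definition variance_on :: "'a set \<Rightarrow> ('a \<Rightarrow> real) \<Rightarrow> ('a \<Rightarrow> real) \<Rightarrow> real" where
  "variance_on S \<mu> f = expectation_on S \<mu> (\<lambda>s. (f s - expectation_on S \<mu> f)\<^sup>2)"

text \<open>
  Observables on a finite state space \<open>S\<close> are total functions of which only the values on
  \<open>S\<close> matter. The minimum of the Rayleigh quotient is written as an infimum; for a finite
  \<open>S\<close> with at least two points, a strictly positive law \<open>\<mu>\<close> and a positive semidefinite
  form \<open>E\<close> it is attained.
\<close>

definition poincare_constant ::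
    "'a set \<Rightarrow> ('a \<Rightarrow> real) \<Rightarrow> (('a \<Rightarrow> real) \<Rightarrow> ('a \<Rightarrow> real) \<Rightarrow> real) \<Rightarrow> real" where
  "poincare_constant S \<mu> E = Inf {E f f / variance_on S \<mu> f | f. \<not> f constant_on S}"

definition dirichlet_form ::
    "real^'v^'v \<Rightarrow> ('v \<Rightarrow> real) \<Rightarrow> ('v \<Rightarrow> real) \<Rightarrow> real" where
  "dirichlet_form P \<phi> \<psi> =
     (\<Sum>x\<in>UNIV. invariant_law P $ x * \<phi> x * ((mat 1 - P) *v (\<chi> y. \<psi> y)) $ x)"

definition poincare_matrix :: "real^'v^'v \<Rightarrow> real" where
  "poincare_matrix P =
     poincare_constant UNIV (\<lambda>x. invariant_law P $ x) (dirichlet_form P)"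

definition zrp_states :: "nat \<Rightarrow> ('v::finite \<Rightarrow> nat) set" where
  "zrp_states m = {\<eta>. (\<Sum>x\<in>UNIV. \<eta> x) = m}"

text \<open>
  \<open>move_particle x y \<eta>\<close> is \<open>\<eta> + \<delta>\<^sub>y - \<delta>\<^sub>x\<close>. The truncated subtraction is harmless when
  \<open>\<eta> x > 0\<close>; when \<open>\<eta> x = 0\<close> the corresponding term of the generator vanishes, as
  \<open>r x 0 = 0\<close>.
\<close>

definition move_particle :: "'v \<Rightarrow> 'v \<Rightarrow> ('v \<Rightarrow> nat) \<Rightarrow> 'v \<Rightarrow> nat" where
  "move_particle x y \<eta> = (\<lambda>z. (\<eta> z + of_bool (z = y)) - of_bool (z = x))"

definition zrp_generator ::
    "real^'v^'v \<Rightarrow> ('v \<Rightarrow> nat \<Rightarrow> real) \<Rightarrow> (('v::finite \<Rightarrow> nat) \<Rightarrow> real) \<Rightarrow> ('v \<Rightarrow> nat) \<Rightarrow> real" where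
  "zrp_generator P r f \<eta> =
     (\<Sum>(x, y)\<in>UNIV. r x (\<eta> x) * P $ x $ y * (f (move_particle x y \<eta>) - f \<eta>))"

definition zrp_weight ::
    "real^'v^'v \<Rightarrow> ('v \<Rightarrow> nat \<Rightarrow> real) \<Rightarrow> ('v::finite \<Rightarrow> nat) \<Rightarrow> real" where
  "zrp_weight P r \<eta> = (\<Prod>x\<in>UNIV. \<Prod>k=1..\<eta> x. invariant_law P $ x / r x k)"

definition zrp_law ::
    "real^'v^'v \<Rightarrow> ('v \<Rightarrow> nat \<Rightarrow> real) \<Rightarrow> nat \<Rightarrow> ('v::finite \<Rightarrow> nat) \<Rightarrow> real" where
  "zrp_law P r m \<eta> = zrp_weight P r \<eta> / (\<Sum>\<xi>\<in>zrp_states m. zrp_weight P r \<xi>)"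

definition zrp_dirichlet_form ::
    "real^'v^'v \<Rightarrow> ('v \<Rightarrow> nat \<Rightarrow> real) \<Rightarrow> nat \<Rightarrow>
     (('v::finite \<Rightarrow> nat) \<Rightarrow> real) \<Rightarrow> (('v \<Rightarrow> nat) \<Rightarrow> real) \<Rightarrow> real" where
  "zrp_dirichlet_form P r m f g =
     - (\<Sum>\<eta>\<in>zrp_states m. zrp_law P r m \<eta> * f \<eta> * zrp_generator P r g \<eta>)"

definition poincare_zrp ::
    "real^'v^'v \<Rightarrow> ('v::finite \<Rightarrow> nat \<Rightarrow> real) \<Rightarrow> nat \<Rightarrow> real" where
  "poincare_zrp P r m =
     poincare_constant (zrp_states m) (zrp_law P r m) (zrp_dirichlet_form P r m)"

text \<open>
  The invariant law is well defined, and uniform, for irreducible doubly stochastic matrices.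
\<close>

lemma matrix_power_column_sum:
  assumes "doubly_stochastic P"
  shows "(\<Sum>x\<in>UNIV. matrix_power P n $ x $ y) = 1"
proof (induction n)
  case 0
  show ?case by (simp add: matrix_power_def mat_def)
next
  case (Suc n)
  have "(\<Sum>x\<in>UNIV. matrix_power P (Suc n) $ x $ y)
      = (\<Sum>x\<in>UNIV. \<Sum>k\<in>UNIV. P $ x $ k * matrix_power P n $ k $ y)"
    by (simp add: matrix_power_def matrix_matrix_mult_def)
  also have "\<dots> = (\<Sum>k\<in>UNIV. \<Sum>x\<in>UNIV. P $ x $ k * matrix_power P n $ k $ y)"
    by (rule sum.swap)
  also have "\<dots> = (\<Sum>k\<in>UNIV. matrix_power P n $ k $ y)"
    using assms by (simp add: doubly_stochastic_def flip: sum_distrib_right)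
  finally show ?case using Suc by simp
qed

lemma matrix_power_nonneg:
  assumes "doubly_stochastic P"
  shows "0 \<le> matrix_power P n $ x $ y"
proof (induction n arbitrary: x)
  case 0
  show ?case by (simp add: matrix_power_def mat_def)
next
  case (Suc n)
  then show ?case
    using assms
    by (auto simp: matrix_power_def matrix_matrix_mult_def doubly_stochastic_def intro!: sum_nonneg)
qed

lemma invariant_matrix_power:
  assumes "p v* P = p"
  shows "p v* matrix_power P n = p"
proof (induction n)
  case 0
  show ?case by (simp add: matrix_power_def)
next
  case (Suc n)
  then show ?case
    using assms by (simp add: matrix_power_def flip: vector_matrix_mul_assoc)
qed

lemma is_invariant_law_unique:
  fixes P :: "real^'v^'v"
  assumes ds: "doubly_stochastic P" and irr: "irreducible_matrix P"
  shows "is_invariant_law P p \<longleftrightarrow> p = (\<chi> x. 1 / real CARD('v))"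
proof
  assume "p = (\<chi> x. 1 / real CARD('v))"
  then show "is_invariant_law P p"
    using ds by (simp add: is_invariant_law_def vector_matrix_mult_def doubly_stochastic_def vec_eq_iff
        flip: sum_divide_distrib)
next
  assume p: "is_invariant_law P p"
  define M where "M = Max (range (\<lambda>x. p $ x))"
  have le: "p $ x \<le> M" for x by (simp add: M_def)
  have "M \<in> range (\<lambda>x. p $ x)" unfolding M_def by (rule Max_in) auto
  then obtain y where y: "p $ y = M" by auto
  have const: "p $ x = M" for x
  proof -
    obtain n where n: "0 < matrix_power P n $ x $ y"
      using irr by (auto simp: irreducible_matrix_def)
    let ?Q = "matrix_power P n"
    have "(\<Sum>z\<in>UNIV. ?Q $ z $ y * (M - p $ z)) = M * (\<Sum>z\<in>UNIV. ?Q $ z $ y) - (p v* ?Q) $ y"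
      by (simp add: vector_matrix_mult_def algebra_simps sum_subtractf sum_distrib_left)
    also have "p v* ?Q = p"
      using p by (intro invariant_matrix_power) (simp add: is_invariant_law_def)
    also have "M * (\<Sum>z\<in>UNIV. ?Q $ z $ y) - p $ y = 0"
      by (simp add: matrix_power_column_sum[OF ds] y)
    finally have "\<forall>z\<in>UNIV. ?Q $ z $ y * (M - p $ z) = 0"
      using sum_nonneg_eq_0_iff[of UNIV "\<lambda>z. ?Q $ z $ y * (M - p $ z)"]
        matrix_power_nonneg[OF ds] le by simp
    then show ?thesis using n by force
  qed
  then have "real CARD('v) * M = 1" using p by (simp add: is_invariant_law_def)
  then show "p = (\<chi> x. 1 / real CARD('v))"
    using const by (simp add: vec_eq_iff field_simps)
qed

lemma invariant_law_uniform:
  fixes P :: "real^'v^'v"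
  assumes "doubly_stochastic P" and "irreducible_matrix P"
  shows "invariant_law P = (\<chi> x. 1 / real CARD('v))"
  unfolding invariant_law_def by (rule the_equality) (use is_invariant_law_unique[OF assms] in blast)+

end

theory Submission
  imports Defs
begin

text \<open>
  Removing the particle that jumps turns the Dirichlet form of the process into an average, over
  configurations \<open>\<zeta>\<close> with \<open>m - 1\<close> particles, of the Dirichlet form of \<open>P\<close> at
  \<open>x \<mapsto> f (\<zeta> + \<delta>\<^sub>x)\<close>. The Poincare inequality for \<open>P\<close>, applied for each \<open>\<zeta>\<close>, thus
  reduces the claim to the mean-field matrix with all entries \<open>1 / |V|\<close>, whose Dirichlet form is
  the variance. Let \<open>\<Delta>\<close> be the infimum of the increments of \<open>r\<close>. In the mean-field process
  two configurations that differ in the position of one particle can be coupled so that they merge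
  at rate at least \<open>\<Delta>\<close> and never get further apart. Hence \<open>I + \<epsilon> L\<close> contracts Lipschitz
  constants by \<open>1 - \<epsilon> \<Delta>\<close>. As the mean-field process is reversible, the same factor bounds
  \<open>I + \<epsilon> L\<close> in \<open>L\<^sup>2\<close> on centred functions.
\<close>

section \<open>Self-adjoint contractions\<close>

text \<open>Log-convexity makes the successive ratios nondecreasing. If the first ratio exceeded
  \<open>q\<close>, then \<open>c\<close> would grow at least geometrically with a ratio above
  \<open>q\<close>, and no constant \<open>C\<close> could keep it below
  \<open>C * q ^ t\<close>.\<close>

lemma log_convex_ratio_le:
  fixes c :: "nat \<Rightarrow> real"
  assumes nonneg: "\<And>t. 0 \<le> c t"
    and convex: "\<And>t. (c (Suc t))\<^sup>2 \<le> c t * c (Suc (Suc t))"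
    and bound: "\<And>t. c t \<le> C * q ^ t"
    and q: "0 < q"
  shows "c 1 \<le> q * c 0"
proof (rule ccontr)
  assume neg: "\<not> c 1 \<le> q * c 0"
  have c0: "0 < c 0"
  proof (rule ccontr)
    assume "\<not> 0 < c 0"
    then have "c 0 = 0" using nonneg[of 0] by simp
    with convex[of 0] neg show False by simp
  qed
  define \<rho> where "\<rho> = c 1 / c 0"
  have \<rho>: "q < \<rho>" using neg c0 by (simp add: \<rho>_def field_simps)
  have step: "0 < c t \<and> \<rho> * c t \<le> c (Suc t)" for t
  proof (induction t)
    case 0
    show ?case using c0 by (simp add: \<rho>_def)
  next
    case (Suc t)
    then have pos: "0 < c (Suc t)"
      using \<rho> q by (smt (verit) mult_pos_pos)
    have "c t * (\<rho> * c (Suc t)) = (\<rho> * c t) * c (Suc t)" by simp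
    also have "\<dots> \<le> c (Suc t) * c (Suc t)" using Suc pos by (intro mult_right_mono) auto
    also have "\<dots> \<le> c t * c (Suc (Suc t))" using convex[of t] by (simp add: power2_eq_square)
    finally show ?case using Suc pos by simp
  qed
  have geo: "\<rho> ^ t * c 0 \<le> c t" for t
  proof (induction t)
    case (Suc t)
    then have "\<rho> * (\<rho> ^ t * c 0) \<le> \<rho> * c t" using \<rho> q by (intro mult_left_mono) auto
    then show ?case using step[of t] by simp
  qed simp
  have "1 < \<rho> / q" using \<rho> q by simp
  then obtain t where "C / c 0 < (\<rho> / q) ^ t" using real_arch_pow by blast
  then have "C * q ^ t < \<rho> ^ t * c 0" using c0 q by (simp add: field_simps power_divide)
  then show False using geo[of t] bound[of t] by simp
qed

lemma weighted_Cauchy_Schwarz: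
  fixes \<mu> f g :: "'a \<Rightarrow> real"
  assumes "\<And>s. s \<in> S \<Longrightarrow> 0 \<le> \<mu> s"
  shows "(\<Sum>s\<in>S. \<mu> s * f s * g s)\<^sup>2 \<le> (\<Sum>s\<in>S. \<mu> s * (f s)\<^sup>2) * (\<Sum>s\<in>S. \<mu> s * (g s)\<^sup>2)"
proof -
  have "(\<Sum>s\<in>S. (sqrt (\<mu> s) * f s) * (sqrt (\<mu> s) * g s))\<^sup>2
      \<le> (\<Sum>s\<in>S. (sqrt (\<mu> s) * f s)\<^sup>2) * (\<Sum>s\<in>S. (sqrt (\<mu> s) * g s)\<^sup>2)"
    by (rule Cauchy_Schwarz_ineq_sum)
  moreover have "(\<Sum>s\<in>S. (sqrt (\<mu> s) * f s) * (sqrt (\<mu> s) * g s)) = (\<Sum>s\<in>S. \<mu> s * f s * g s)"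
    using assms by (intro sum.cong) (auto simp: algebra_simps)
  moreover have "(\<Sum>s\<in>S. (sqrt (\<mu> s) * h s)\<^sup>2) = (\<Sum>s\<in>S. \<mu> s * (h s)\<^sup>2)" for h
    using assms by (intro sum.cong) (auto simp: power_mult_distrib)
  ultimately show ?thesis by simp
qed

text \<open>By symmetry and Cauchy-Schwarz the squared norms of the iterates of \<open>f\<close> are
  log-convex in \<open>t\<close>. Hence a decay rate valid only up to a constant \<open>C\<close>,
  and possibly obtained in another norm, already holds with constant 1 for the first step. This
  replaces an appeal to the spectral theorem.\<close>

lemma selfadjoint_rayleigh_le:
  fixes \<mu> f :: "'a \<Rightarrow> real"
  assumes \<mu>: "\<And>s. s \<in> S \<Longrightarrow> 0 \<le> \<mu> s"
    and sym: "\<And>g h. (\<Sum>s\<in>S. \<mu> s * g s * K h s) = (\<Sum>s\<in>S. \<mu> s * h s * K g s)"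
    and bound: "\<And>t. (\<Sum>s\<in>S. \<mu> s * ((K ^^ t) f s)\<^sup>2) \<le> C * (q\<^sup>2) ^ t"
    and q: "0 < q"
  shows "(\<Sum>s\<in>S. \<mu> s * f s * K f s) \<le> q * (\<Sum>s\<in>S. \<mu> s * (f s)\<^sup>2)"
proof -
  define c where "c t = (\<Sum>s\<in>S. \<mu> s * ((K ^^ t) f s)\<^sup>2)" for t
  have c_nonneg: "0 \<le> c t" for t
    using \<mu> by (auto simp: c_def intro!: sum_nonneg)
  have "(c (Suc t))\<^sup>2 \<le> c t * c (Suc (Suc t))" for t
  proof -
    have "c (Suc t) = (\<Sum>s\<in>S. \<mu> s * K ((K ^^ t) f) s * K ((K ^^ t) f) s)"
      by (simp add: c_def power2_eq_square mult.assoc)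
    also have "\<dots> = (\<Sum>s\<in>S. \<mu> s * (K ^^ t) f s * K (K ((K ^^ t) f)) s)"
      by (rule sym)
    finally show ?thesis
      using weighted_Cauchy_Schwarz[where S=S and \<mu>=\<mu> and f="(K ^^ t) f"
          and g="K (K ((K ^^ t) f))", OF \<mu>]
      by (simp add: c_def)
  qed
  then have c1: "c 1 \<le> q\<^sup>2 * c 0"
    using bound q by (intro log_convex_ratio_le[where C=C] c_nonneg) (auto simp: c_def)
  have "(\<Sum>s\<in>S. \<mu> s * f s * K f s)\<^sup>2 \<le> c 0 * c 1"
    using weighted_Cauchy_Schwarz[where S=S and \<mu>=\<mu> and f=f and g="K f", OF \<mu>]
    by (simp add: c_def)
  also have "\<dots> \<le> c 0 * (q\<^sup>2 * c 0)" by (rule mult_left_mono[OF c1 c_nonneg])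
  also have "\<dots> = (q * c 0)\<^sup>2" by (simp add: power2_eq_square)
  finally have "(\<Sum>s\<in>S. \<mu> s * f s * K f s) \<le> q * c 0"
    by (rule power2_le_imp_le) (use q c_nonneg in simp)
  then show ?thesis by (simp add: c_def)
qed

section \<open>Configurations\<close>

definition add_particle :: "'v \<Rightarrow> ('v \<Rightarrow> nat) \<Rightarrow> 'v \<Rightarrow> nat" where
  "add_particle x \<zeta> = (\<lambda>z. \<zeta> z + of_bool (z = x))"

lemma add_particle_apply: "add_particle x \<zeta> z = (if z = x then Suc (\<zeta> z) else \<zeta> z)"
  by (simp add: add_particle_def)

text \<open>Splitting off the jumping particle turns a jump into a change of the added site, which
  keeps truncated subtraction out of the later arguments.\<close>

lemma move_add_particle: "move_particle x y (add_particle x \<zeta>) = add_particle y \<zeta>"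
  by (auto simp: move_particle_def add_particle_def)

lemma add_particle_commute: "add_particle x (add_particle y \<zeta>) = add_particle y (add_particle x \<zeta>)"
  by (auto simp: add_particle_def)

lemma inj_add_particle: "inj (add_particle x)"
  by (auto simp: inj_def add_particle_def fun_eq_iff)

lemma remove_particle:
  assumes "0 < \<eta> x"
  obtains \<zeta> where "\<eta> = add_particle x \<zeta>"
proof
  show "\<eta> = add_particle x (\<eta>(x := \<eta> x - 1))"
    using assms by (auto simp: add_particle_def)
qed

text \<open>The hypothesis lets a particle of \<zeta> make the jump, so that the extra one stays at
  \<open>a\<close>. With \<open>x\<close> empty in \<zeta> and \<open>a = x\<close>, the left side
  would move the extra particle instead.\<close>

lemma move_particle_add_particle:
  assumes "0 < \<zeta> x"
  shows "move_particle x y (add_particle a \<zeta>) = add_particle a (move_particle x y \<zeta>)"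
  using assms by (metis remove_particle move_add_particle add_particle_commute)

lemma finite_zrp_states: "finite (zrp_states m :: ('v::finite \<Rightarrow> nat) set)"
proof (rule finite_subset)
  show "(zrp_states m :: ('v \<Rightarrow> nat) set) \<subseteq> PiE UNIV (\<lambda>_. {..m})"
    by (auto simp: zrp_states_def intro!: member_le_sum)
qed (simp add: finite_PiE)

lemma add_particle_zrp_states: "add_particle x \<zeta> \<in> zrp_states (Suc k) \<longleftrightarrow> \<zeta> \<in> zrp_states k"
  by (simp add: zrp_states_def add_particle_def sum.distrib of_bool_def)

lemma move_particle_zrp_states:
  assumes "\<zeta> \<in> zrp_states k" "0 < \<zeta> x"
  shows "move_particle x y \<zeta> \<in> zrp_states k"
proof -
  obtain \<xi> where \<xi>: "\<zeta> = add_particle x \<xi>" using assms(2) by (rule remove_particle)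
  obtain l where "k = Suc l"
    using assms by (cases k) (auto simp: zrp_states_def)
  with assms \<xi> show ?thesis by (simp add: move_add_particle add_particle_zrp_states)
qed

lemma zrp_states_Suc_obtain:
  assumes "\<eta> \<in> zrp_states (Suc k)"
  obtains x \<zeta> where "\<eta> = add_particle x \<zeta>" "\<zeta> \<in> zrp_states k"
proof -
  have "sum \<eta> UNIV \<noteq> 0" using assms by (simp add: zrp_states_def)
  then obtain x where "0 < \<eta> x" by auto
  then obtain \<zeta> where "\<eta> = add_particle x \<zeta>" by (rule remove_particle)
  with that assms show ?thesis by (simp add: add_particle_zrp_states)
qed

lemma zrp_states_nonempty: "(zrp_states m :: ('v::finite \<Rightarrow> nat) set) \<noteq> {}"
proof -
  have "(\<lambda>z. if z = undefined then m else 0) \<in> (zrp_states m :: ('v \<Rightarrow> nat) set)"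
    by (simp add: zrp_states_def)
  then show ?thesis by blast
qed

section \<open>Lipschitz functions of the configuration\<close>

text \<open>Here \<open>k\<close> counts the particles shared by two neighbouring configurations, so
  \<open>g\<close> is tested on configurations of \<open>Suc k\<close> particles. The distance
  behind it is the number of particles to be displaced.\<close>

definition particle_lipschitz :: "nat \<Rightarrow> real \<Rightarrow> (('v::finite \<Rightarrow> nat) \<Rightarrow> real) \<Rightarrow> bool" where
  "particle_lipschitz k L g \<longleftrightarrow>
     (\<forall>\<zeta>\<in>zrp_states k. \<forall>a b. \<bar>g (add_particle a \<zeta>) - g (add_particle b \<zeta>)\<bar> \<le> L)"

lemma particle_lipschitzD:
  "particle_lipschitz k L g \<Longrightarrow> \<zeta> \<in> zrp_states k \<Longrightarrow>
    \<bar>g (add_particle a \<zeta>) - g (add_particle b \<zeta>)\<bar> \<le> L"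
  by (auto simp: particle_lipschitz_def)

lemma particle_lipschitz_exists:
  fixes g :: "('v::finite \<Rightarrow> nat) \<Rightarrow> real"
  obtains L where "particle_lipschitz k L g"
proof
  let ?B = "\<Sum>\<eta>\<in>zrp_states (Suc k). \<bar>g \<eta>\<bar>"
  have "\<bar>g \<eta>\<bar> \<le> ?B" if "\<eta> \<in> zrp_states (Suc k)" for \<eta>
    using that finite_zrp_states by (intro member_le_sum) auto
  then show "particle_lipschitz k (2 * ?B) g"
    unfolding particle_lipschitz_def by (smt (verit) add_particle_zrp_states)
qed

lemma particle_lipschitz_oscillation:
  assumes "particle_lipschitz k L g" "\<eta> \<in> zrp_states (Suc k)" "\<xi> \<in> zrp_states (Suc k)"
  shows "\<bar>g \<eta> - g \<xi>\<bar> \<le> real (Suc k) * L"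
  using assms
proof (induction k arbitrary: g \<eta> \<xi>)
  case 0
  obtain a \<eta>' where "\<eta> = add_particle a \<eta>'" "\<eta>' \<in> zrp_states 0"
    using 0(2) by (rule zrp_states_Suc_obtain)
  moreover obtain b \<xi>' where "\<xi> = add_particle b \<xi>'" "\<xi>' \<in> zrp_states 0"
    using 0(3) by (rule zrp_states_Suc_obtain)
  moreover from calculation have "\<eta>' = \<xi>'" by (auto simp: zrp_states_def)
  ultimately show ?case using particle_lipschitzD[OF 0(1)] by simp
next
  case (Suc k)
  obtain a \<eta>' where \<eta>: "\<eta> = add_particle a \<eta>'" "\<eta>' \<in> zrp_states (Suc k)"
    using Suc.prems(2) by (rule zrp_states_Suc_obtain)
  obtain b \<xi>' where \<xi>: "\<xi> = add_particle b \<xi>'" "\<xi>' \<in> zrp_states (Suc k)"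
    using Suc.prems(3) by (rule zrp_states_Suc_obtain)
  have "particle_lipschitz k L (\<lambda>\<zeta>. g (add_particle b \<zeta>))"
    unfolding particle_lipschitz_def
  proof (intro ballI allI)
    fix \<zeta> :: "'a \<Rightarrow> nat" and x y assume "\<zeta> \<in> zrp_states k"
    then show "\<bar>g (add_particle b (add_particle x \<zeta>)) - g (add_particle b (add_particle y \<zeta>))\<bar> \<le> L"
      using particle_lipschitzD[OF Suc.prems(1), of "add_particle b \<zeta>" x y]
      by (simp add: add_particle_zrp_states add_particle_commute[of b])
  qed
  from Suc.IH[OF this \<eta>(2) \<xi>(2)]
  have "\<bar>g (add_particle b \<eta>') - g \<xi>\<bar> \<le> real (Suc k) * L" by (simp add: \<xi>)
  moreover have "\<bar>g \<eta> - g (add_particle b \<eta>')\<bar> \<le> L"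
    using particle_lipschitzD[OF Suc.prems(1) \<eta>(2)] \<eta> by simp
  ultimately show ?case by (simp add: algebra_simps)
qed

section \<open>Dirichlet forms\<close>

lemma dirichlet_form_expand:
  fixes P :: "real^'v^'v"
  assumes "doubly_stochastic P" "irreducible_matrix P"
  shows "dirichlet_form P \<phi> \<psi> =
    (\<Sum>x\<in>UNIV. \<Sum>y\<in>UNIV. P $ x $ y * \<phi> x * (\<psi> x - \<psi> y)) / real CARD('v)"
proof -
  have "((mat 1 - P) *v (\<chi> y. \<psi> y)) $ x = (\<Sum>y\<in>UNIV. P $ x $ y * (\<psi> x - \<psi> y))" for x
  proof -
    have "((mat 1 - P) *v (\<chi> y. \<psi> y)) $ x = \<psi> x - (\<Sum>y\<in>UNIV. P $ x $ y * \<psi> y)"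
      by (simp add: matrix_vector_mult_diff_rdistrib) (simp add: matrix_vector_mult_def)
    also have "\<dots> = (\<Sum>y\<in>UNIV. P $ x $ y) * \<psi> x - (\<Sum>y\<in>UNIV. P $ x $ y * \<psi> y)"
      using assms by (simp add: doubly_stochastic_def)
    also have "\<dots> = (\<Sum>y\<in>UNIV. P $ x $ y * (\<psi> x - \<psi> y))"
      by (simp add: sum_distrib_right sum_subtractf right_diff_distrib)
    finally show ?thesis .
  qed
  then show ?thesis
    by (simp add: dirichlet_form_def invariant_law_uniform[OF assms] sum_divide_distrib
        sum_distrib_left mult_ac)
qed

text \<open>Without reversibility the form is still half a weighted sum of squared differences: the
  row sums handle the squares at \<open>x\<close> and the column sums those at
  \<open>y\<close>.\<close>

lemma dirichlet_form_nonneg: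
  fixes P :: "real^'v^'v"
  assumes "doubly_stochastic P" "irreducible_matrix P"
  shows "0 \<le> dirichlet_form P \<phi> \<phi>"
proof -
  have row: "(\<Sum>y\<in>UNIV. P $ x $ y) = 1" and col: "(\<Sum>y\<in>UNIV. P $ y $ x) = 1"
    and nn: "0 \<le> P $ x $ y" for x y
    using assms by (auto simp: doubly_stochastic_def)
  have "(\<Sum>x\<in>UNIV. \<Sum>y\<in>UNIV. P $ x $ y * (\<phi> x)\<^sup>2) = (\<Sum>x\<in>UNIV. (\<phi> x)\<^sup>2)"
    by (simp add: row flip: sum_distrib_right)
  moreover have "(\<Sum>x\<in>UNIV. \<Sum>y\<in>UNIV. P $ x $ y * (\<phi> y)\<^sup>2) = (\<Sum>x\<in>UNIV. (\<phi> x)\<^sup>2)"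
    by (subst sum.swap) (simp add: col flip: sum_distrib_right)
  ultimately have "(\<Sum>x\<in>UNIV. \<Sum>y\<in>UNIV. P $ x $ y * (\<phi> x - \<phi> y)\<^sup>2)
    = 2 * (\<Sum>x\<in>UNIV. \<Sum>y\<in>UNIV. P $ x $ y * \<phi> x * (\<phi> x - \<phi> y))"
    by (simp add: power2_eq_square algebra_simps sum.distrib sum_subtractf sum_distrib_left)
  moreover have "0 \<le> (\<Sum>x\<in>UNIV. \<Sum>y\<in>UNIV. P $ x $ y * (\<phi> x - \<phi> y)\<^sup>2)"
    by (intro sum_nonneg mult_nonneg_nonneg nn) simp
  ultimately show ?thesis by (simp add: dirichlet_form_expand[OF assms])
qed

lemma variance_on_nonneg:
  assumes "\<And>s. s \<in> S \<Longrightarrow> 0 \<le> \<mu> s"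
  shows "0 \<le> variance_on S \<mu> f"
  using assms by (auto simp: variance_on_def expectation_on_def intro!: sum_nonneg)

lemma variance_on_eq_0:
  assumes "f constant_on S" "sum \<mu> S = 1"
  shows "variance_on S \<mu> f = 0"
proof -
  obtain c where c: "\<And>s. s \<in> S \<Longrightarrow> f s = c"
    using assms(1) by (auto simp: constant_on_def)
  have "expectation_on S \<mu> f = (\<Sum>s\<in>S. \<mu> s * c)"
    unfolding expectation_on_def by (intro sum.cong) (simp_all add: c)
  then have "expectation_on S \<mu> f = c" using assms(2) by (simp flip: sum_distrib_right)
  then show ?thesis by (simp add: variance_on_def) (simp add: expectation_on_def c)
qed

text \<open>The non-constant witness ensures that the infimum is taken over a nonempty set.\<close>

lemma poincare_constant_nonneg:
  assumes "\<And>s. s \<in> S \<Longrightarrow> 0 \<le> \<mu> s" "\<And>f. 0 \<le> E f f" "\<not> (f :: 'a \<Rightarrow> real) constant_on S"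
  shows "0 \<le> poincare_constant S \<mu> E"
  unfolding poincare_constant_def
  using assms by (intro cInf_greatest) (auto intro!: divide_nonneg_nonneg variance_on_nonneg)

lemma poincare_inequality:
  assumes "\<And>s. s \<in> S \<Longrightarrow> 0 \<le> \<mu> s" "sum \<mu> S = 1" "\<And>f. 0 \<le> E f f"
  shows "poincare_constant S \<mu> E * variance_on S \<mu> f \<le> E f f"
proof (cases "variance_on S \<mu> f = 0")
  case True
  then show ?thesis using assms(3) by simp
next
  case False
  then have pos: "0 < variance_on S \<mu> f"
    using variance_on_nonneg[of S \<mu> f] assms(1) by force
  have "poincare_constant S \<mu> E \<le> E f f / variance_on S \<mu> f"
    unfolding poincare_constant_def
  proof (rule cInf_lower)
    have "\<not> f constant_on S" using False assms(2) variance_on_eq_0 by blast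
    then show "E f f / variance_on S \<mu> f \<in> {E f f / variance_on S \<mu> f |f. \<not> f constant_on S}"
      by blast
    show "bdd_below {E f f / variance_on S \<mu> f |f. \<not> f constant_on S}"
      using assms by (intro bdd_belowI[of _ 0]) (auto intro!: divide_nonneg_nonneg variance_on_nonneg)
  qed
  then show ?thesis using pos by (simp add: field_simps)
qed

definition mean_field :: "real^'v^'v" where
  "mean_field = (\<chi> x y. 1 / real CARD('v))"

lemma doubly_stochastic_mean_field: "doubly_stochastic mean_field"
  by (simp add: doubly_stochastic_def mean_field_def)

lemma irreducible_mean_field: "irreducible_matrix (mean_field :: real^'v^'v)"
proof -
  have "0 < matrix_power (mean_field :: real^'v^'v) 1 $ x $ y" for x y
    by (simp add: matrix_power_def) (simp add: mean_field_def)
  then show ?thesis unfolding irreducible_matrix_def by blast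
qed

text \<open>The right side is the covariance under the uniform law. Its symmetry is the source of
  the reversibility of the mean-field process.\<close>

lemma dirichlet_form_mean_field:
  fixes \<phi> \<psi> :: "'v::finite \<Rightarrow> real"
  shows "dirichlet_form mean_field \<phi> \<psi> = (\<Sum>x\<in>UNIV. \<phi> x * \<psi> x) / real CARD('v)
    - (\<Sum>x\<in>UNIV. \<phi> x) * (\<Sum>x\<in>UNIV. \<psi> x) / (real CARD('v))\<^sup>2"
proof -
  have "(\<Sum>x\<in>UNIV. \<Sum>y\<in>UNIV. 1 / real CARD('v) * \<phi> x * (\<psi> x - \<psi> y))
    = (\<Sum>x\<in>UNIV. \<phi> x * \<psi> x - \<phi> x * (\<Sum>y\<in>UNIV. \<psi> y) / real CARD('v))"
    by (intro sum.cong refl)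
      (simp add: right_diff_distrib sum_subtractf flip: sum_distrib_left sum_divide_distrib)
  also have "\<dots> = (\<Sum>x\<in>UNIV. \<phi> x * \<psi> x) - (\<Sum>x\<in>UNIV. \<phi> x) * (\<Sum>y\<in>UNIV. \<psi> y) / real CARD('v)"
    by (simp add: sum_subtractf flip: sum_distrib_right sum_divide_distrib)
  finally show ?thesis
    by (simp add: dirichlet_form_expand[OF doubly_stochastic_mean_field irreducible_mean_field])
      (simp add: mean_field_def diff_divide_distrib power2_eq_square)
qed

text \<open>This identity turns the Poincare inequality for a matrix into a comparison of its
  Dirichlet form with that of \<open>mean_field\<close>.\<close>

lemma variance_uniform:
  fixes \<phi> :: "'v::finite \<Rightarrow> real"
  shows "variance_on UNIV (\<lambda>_. 1 / real CARD('v)) \<phi> = dirichlet_form mean_field \<phi> \<phi>"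
proof -
  define e where "e = (\<Sum>x\<in>UNIV. \<phi> x) / real CARD('v)"
  have e: "(\<Sum>x\<in>UNIV. \<phi> x) = real CARD('v) * e" by (simp add: e_def)
  have "variance_on UNIV (\<lambda>_. 1 / real CARD('v)) \<phi> = (\<Sum>x\<in>UNIV. (\<phi> x - e)\<^sup>2) / real CARD('v)"
    by (simp add: variance_on_def expectation_on_def e_def flip: sum_divide_distrib)
  also have "(\<Sum>x\<in>UNIV. (\<phi> x - e)\<^sup>2)
      = (\<Sum>x\<in>UNIV. \<phi> x * \<phi> x) - 2 * e * (\<Sum>x\<in>UNIV. \<phi> x) + real CARD('v) * e\<^sup>2"
    by (simp add: power2_eq_square algebra_simps sum.distrib sum_subtractf sum_distrib_left sum_distrib_right)
  finally show ?thesis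
    unfolding dirichlet_form_mean_field e by (simp add: field_simps power2_eq_square)
qed

section \<open>The zero-range process\<close>

locale zrp_rates =
  fixes r :: "'v::finite \<Rightarrow> nat \<Rightarrow> real"
  assumes rate_pos: "\<And>x k. 1 \<le> k \<Longrightarrow> 0 < r x k" and rate_0: "\<And>x. r x 0 = 0"
begin

lemma rate_nonneg: "0 \<le> r x k"
  using rate_pos[of k x] rate_0[of x] by (cases k) auto

text \<open>The uniform invariant law is inserted here, so that neither \<open>weight\<close> nor
  \<open>law\<close> mentions a matrix. Processes with different doubly stochastic matrices thus
  visibly share one stationary law.\<close>

definition weight :: "('v \<Rightarrow> nat) \<Rightarrow> real" where
  "weight \<eta> = (\<Prod>x\<in>UNIV. \<Prod>k=1..\<eta> x. 1 / real CARD('v) / r x k)"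

definition law :: "nat \<Rightarrow> ('v \<Rightarrow> nat) \<Rightarrow> real" where
  "law m \<eta> = weight \<eta> / sum weight (zrp_states m)"

lemma zrp_law_eq:
  assumes "doubly_stochastic P" "irreducible_matrix P"
  shows "zrp_law P r m = law m"
  by (simp add: fun_eq_iff zrp_law_def law_def zrp_weight_def weight_def
      invariant_law_uniform[OF assms])

lemma weight_pos: "0 < weight \<eta>"
  unfolding weight_def by (intro prod_pos ballI divide_pos_pos rate_pos) auto

lemma sum_weight_pos: "0 < sum weight (zrp_states m)"
  using finite_zrp_states zrp_states_nonempty weight_pos by (intro sum_pos) auto

lemma law_nonneg: "0 \<le> law m \<eta>"
  using weight_pos[of \<eta>] sum_weight_pos[of m] by (simp add: law_def)

lemma sum_law: "sum (law m) (zrp_states m) = 1"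
  using sum_weight_pos[of m] by (simp add: law_def flip: sum_divide_distrib)

text \<open>The new factor of the product cancels the rate at which the added particle leaves. What
  remains does not depend on \<open>x\<close>.\<close>

lemma weight_add_particle: "weight (add_particle x \<zeta>) * r x (Suc (\<zeta> x)) = weight \<zeta> / real CARD('v)"
proof -
  let ?p = "\<lambda>\<eta> z. \<Prod>k=1..\<eta> z. 1 / real CARD('v) / r z k"
  have "weight (add_particle x \<zeta>) = ?p (add_particle x \<zeta>) x * (\<Prod>z\<in>UNIV - {x}. ?p (add_particle x \<zeta>) z)"
    unfolding weight_def by (rule prod.remove) auto
  also have "(\<Prod>z\<in>UNIV - {x}. ?p (add_particle x \<zeta>) z) = (\<Prod>z\<in>UNIV - {x}. ?p \<zeta> z)"
    by (intro prod.cong) (auto simp: add_particle_apply)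
  also have "?p (add_particle x \<zeta>) x = ?p \<zeta> x * (1 / real CARD('v) / r x (Suc (\<zeta> x)))"
    by (simp add: add_particle_apply)
  finally have "weight (add_particle x \<zeta>) * r x (Suc (\<zeta> x))
      = ?p \<zeta> x * (\<Prod>z\<in>UNIV - {x}. ?p \<zeta> z) / real CARD('v)"
    using rate_pos[of "Suc (\<zeta> x)" x] by simp
  also have "?p \<zeta> x * (\<Prod>z\<in>UNIV - {x}. ?p \<zeta> z) = weight \<zeta>"
    unfolding weight_def by (rule prod.remove[symmetric]) auto
  finally show ?thesis .
qed

text \<open>This is the change of variables \<eta> = \<zeta> + \<delta>_x. Configurations with
  \<open>x\<close> empty are not of this form, but their rate is zero.\<close>

lemma sum_weight_rate:
  "(\<Sum>\<eta>\<in>zrp_states (Suc k). weight \<eta> * r x (\<eta> x) * F \<eta>)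
    = (\<Sum>\<zeta>\<in>zrp_states k. weight \<zeta> * F (add_particle x \<zeta>)) / real CARD('v)"
proof -
  let ?S = "add_particle x ` zrp_states k"
  have "(\<Sum>\<eta>\<in>zrp_states (Suc k). weight \<eta> * r x (\<eta> x) * F \<eta>)
      = (\<Sum>\<eta>\<in>?S. weight \<eta> * r x (\<eta> x) * F \<eta>)"
  proof (rule sum.mono_neutral_right)
    show "\<forall>\<eta>\<in>zrp_states (Suc k) - ?S. weight \<eta> * r x (\<eta> x) * F \<eta> = 0"
    proof
      fix \<eta> assume \<eta>: "\<eta> \<in> zrp_states (Suc k) - ?S"
      have "\<eta> x = 0"
      proof (rule ccontr)
        assume "\<eta> x \<noteq> 0"
        then have "0 < \<eta> x" by simp
        then obtain \<zeta> where "\<eta> = add_particle x \<zeta>" by (rule remove_particle)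
        with \<eta> show False by (auto simp: add_particle_zrp_states)
      qed
      then show "weight \<eta> * r x (\<eta> x) * F \<eta> = 0" by (simp add: rate_0)
    qed
  qed (auto simp: finite_zrp_states add_particle_zrp_states)
  also have "\<dots> = (\<Sum>\<zeta>\<in>zrp_states k. weight (add_particle x \<zeta>) * r x (Suc (\<zeta> x)) * F (add_particle x \<zeta>))"
    by (subst sum.reindex[OF inj_on_subset[OF inj_add_particle subset_UNIV]])
      (simp add: add_particle_apply)
  finally show ?thesis by (simp add: weight_add_particle sum_divide_distrib)
qed

text \<open>After \<open>sum_weight_rate\<close> is applied for each pair of sites, the weight of
  \<zeta> is common to all pairs, and the factor 1/|V| is the invariant law inside
  \<open>dirichlet_form P\<close>. Two arguments \<open>f\<close> and \<open>g\<close> are kept so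
  that symmetry can be read off later.\<close>

lemma zrp_dirichlet_form_eq:
  assumes "doubly_stochastic P" "irreducible_matrix P"
  shows "zrp_dirichlet_form P r (Suc k) f g =
    (\<Sum>\<zeta>\<in>zrp_states k. weight \<zeta> *
      dirichlet_form P (\<lambda>x. f (add_particle x \<zeta>)) (\<lambda>x. g (add_particle x \<zeta>)))
    / sum weight (zrp_states (Suc k))"
proof -
  let ?n = "real CARD('v)" and ?Z = "sum weight (zrp_states (Suc k))"
  have "(\<Sum>\<eta>\<in>zrp_states (Suc k). weight \<eta> * f \<eta> * zrp_generator P r g \<eta>)
      = (\<Sum>\<eta>\<in>zrp_states (Suc k). \<Sum>(x, y)\<in>UNIV.
          weight \<eta> * r x (\<eta> x) * (P $ x $ y * f \<eta> * (g (move_particle x y \<eta>) - g \<eta>)))"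
    by (intro sum.cong refl)
      (simp add: zrp_generator_def sum_distrib_left case_prod_unfold mult_ac)
  also have "\<dots> = (\<Sum>(x, y)\<in>UNIV. \<Sum>\<eta>\<in>zrp_states (Suc k).
          weight \<eta> * r x (\<eta> x) * (P $ x $ y * f \<eta> * (g (move_particle x y \<eta>) - g \<eta>)))"
    by (subst sum.swap) (simp add: case_prod_unfold)
  also have "\<dots> = (\<Sum>(x, y)\<in>UNIV. \<Sum>\<zeta>\<in>zrp_states k. weight \<zeta> *
        (P $ x $ y * f (add_particle x \<zeta>) * (g (add_particle y \<zeta>) - g (add_particle x \<zeta>))) / ?n)"
    by (simp add: sum_weight_rate move_add_particle sum_divide_distrib)
  also have "\<dots> = (\<Sum>\<zeta>\<in>zrp_states k. \<Sum>(x, y)\<in>UNIV. weight \<zeta> *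
        (P $ x $ y * f (add_particle x \<zeta>) * (g (add_particle y \<zeta>) - g (add_particle x \<zeta>))) / ?n)"
    by (subst sum.swap) (simp add: case_prod_unfold)
  also have "\<dots> = - (\<Sum>\<zeta>\<in>zrp_states k. weight \<zeta> *
      dirichlet_form P (\<lambda>x. f (add_particle x \<zeta>)) (\<lambda>x. g (add_particle x \<zeta>)))"
    unfolding sum_negf[symmetric]
  proof (intro sum.cong refl)
    fix \<zeta> :: "'v \<Rightarrow> nat"
    have "(\<Sum>(x, y)\<in>UNIV. weight \<zeta> * (P $ x $ y * f (add_particle x \<zeta>) *
          (g (add_particle y \<zeta>) - g (add_particle x \<zeta>))) / ?n)
      = (\<Sum>x\<in>UNIV. \<Sum>y\<in>UNIV. - (weight \<zeta> * (P $ x $ y * f (add_particle x \<zeta>) *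
          (g (add_particle x \<zeta>) - g (add_particle y \<zeta>))) / ?n))"
      unfolding UNIV_Times_UNIV[symmetric] sum.cartesian_product[symmetric]
      by (intro sum.cong refl) (simp add: algebra_simps diff_divide_distrib)
    also have "\<dots> = - (weight \<zeta> *
      dirichlet_form P (\<lambda>x. f (add_particle x \<zeta>)) (\<lambda>x. g (add_particle x \<zeta>)))"
      by (simp add: dirichlet_form_expand[OF assms] sum_negf sum_distrib_left sum_divide_distrib)
    finally show "(\<Sum>(x, y)\<in>UNIV. weight \<zeta> * (P $ x $ y * f (add_particle x \<zeta>) *
          (g (add_particle y \<zeta>) - g (add_particle x \<zeta>))) / ?n) = - (weight \<zeta> *
      dirichlet_form P (\<lambda>x. f (add_particle x \<zeta>)) (\<lambda>x. g (add_particle x \<zeta>)))" .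
  qed
  finally have *: "(\<Sum>\<eta>\<in>zrp_states (Suc k). weight \<eta> * f \<eta> * zrp_generator P r g \<eta>) =
    - (\<Sum>\<zeta>\<in>zrp_states k. weight \<zeta> *
      dirichlet_form P (\<lambda>x. f (add_particle x \<zeta>)) (\<lambda>x. g (add_particle x \<zeta>)))" .
  have "zrp_dirichlet_form P r (Suc k) f g
      = - ((\<Sum>\<eta>\<in>zrp_states (Suc k). weight \<eta> * f \<eta> * zrp_generator P r g \<eta>) / ?Z)"
    by (simp add: zrp_dirichlet_form_def zrp_law_eq[OF assms] law_def sum_divide_distrib)
  then show ?thesis by (simp add: *)
qed

lemma zrp_dirichlet_form_nonneg:
  assumes "doubly_stochastic P" "irreducible_matrix P"
  shows "0 \<le> zrp_dirichlet_form P r (Suc k) f f"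
  unfolding zrp_dirichlet_form_eq[OF assms]
  using sum_weight_pos weight_pos dirichlet_form_nonneg[OF assms]
  by (intro divide_nonneg_nonneg sum_nonneg mult_nonneg_nonneg) (auto intro: less_imp_le)

text \<open>Both sides are averages over \<zeta> with the same weights, so the Poincare inequality
  for \<open>P\<close> can be applied term by term.\<close>

lemma zrp_dirichlet_form_comparison:
  assumes "doubly_stochastic P" "irreducible_matrix P"
  shows "poincare_matrix P * zrp_dirichlet_form mean_field r (Suc k) f f
    \<le> zrp_dirichlet_form P r (Suc k) f f"
proof -
  have "poincare_matrix P * dirichlet_form mean_field \<phi> \<phi> \<le> dirichlet_form P \<phi> \<phi>" for \<phi>
    using poincare_inequality[of UNIV "\<lambda>_. 1 / real CARD('v)" "dirichlet_form P" \<phi>]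
      dirichlet_form_nonneg[OF assms]
    by (simp add: poincare_matrix_def invariant_law_uniform[OF assms] variance_uniform)
  then have "(\<Sum>\<zeta>\<in>zrp_states k. weight \<zeta> * (poincare_matrix P *
        dirichlet_form mean_field (\<lambda>x. f (add_particle x \<zeta>)) (\<lambda>x. f (add_particle x \<zeta>))))
      / sum weight (zrp_states (Suc k))
    \<le> zrp_dirichlet_form P r (Suc k) f f"
    unfolding zrp_dirichlet_form_eq[OF assms]
    by (intro divide_right_mono sum_mono mult_left_mono less_imp_le[OF weight_pos]
        less_imp_le[OF sum_weight_pos])
  then show ?thesis
    by (simp add: zrp_dirichlet_form_eq doubly_stochastic_mean_field irreducible_mean_field
        sum_distrib_left mult_ac)
qed

section \<open>The mean-field process\<close>

abbreviation mf_generator :: "(('v \<Rightarrow> nat) \<Rightarrow> real) \<Rightarrow> ('v \<Rightarrow> nat) \<Rightarrow> real" where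
  "mf_generator \<equiv> zrp_generator mean_field r"

lemma mf_generator_eq:
  "mf_generator g \<eta> =
    (\<Sum>x\<in>UNIV. r x (\<eta> x) * ((\<Sum>y\<in>UNIV. g (move_particle x y \<eta>)) / real CARD('v) - g \<eta>))"
proof -
  have "mf_generator g \<eta> = (\<Sum>x\<in>UNIV. \<Sum>y\<in>UNIV.
      r x (\<eta> x) * (1 / real CARD('v)) * (g (move_particle x y \<eta>) - g \<eta>))"
    unfolding zrp_generator_def UNIV_Times_UNIV[symmetric] sum.cartesian_product[symmetric]
    by (simp add: mean_field_def)
  also have "\<dots> = (\<Sum>x\<in>UNIV. r x (\<eta> x) * ((\<Sum>y\<in>UNIV. g (move_particle x y \<eta>)) / real CARD('v) - g \<eta>))"
    by (intro sum.cong refl)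
      (simp add: sum_subtractf right_diff_distrib flip: sum_distrib_left sum_divide_distrib)
  finally show ?thesis .
qed

lemma mf_dirichlet_form:
  "(\<Sum>\<eta>\<in>zrp_states m. law m \<eta> * f \<eta> * mf_generator g \<eta>) = - zrp_dirichlet_form mean_field r m f g"
  by (simp add: zrp_dirichlet_form_def
      zrp_law_eq[OF doubly_stochastic_mean_field irreducible_mean_field])

lemma mf_dirichlet_form_commute:
  "zrp_dirichlet_form mean_field r (Suc k) f g = zrp_dirichlet_form mean_field r (Suc k) g f"
  by (simp add: zrp_dirichlet_form_eq doubly_stochastic_mean_field irreducible_mean_field
      dirichlet_form_mean_field mult.commute)

text \<open>Stationarity follows from symmetry, since the generator vanishes on constants.\<close>

lemma expectation_mf_generator:
  "(\<Sum>\<eta>\<in>zrp_states (Suc k). law (Suc k) \<eta> * mf_generator g \<eta>) = 0"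
proof -
  have "mf_generator (\<lambda>_. 1) \<eta> = 0" for \<eta> by (simp add: mf_generator_eq)
  then show ?thesis
    using mf_dirichlet_form[of "Suc k" "\<lambda>_. 1" g] mf_dirichlet_form[of "Suc k" g "\<lambda>_. 1"]
      mf_dirichlet_form_commute[of k "\<lambda>_. 1" g] by simp
qed

text \<open>One discrete time step I + \<epsilon> L takes the place of the semigroup, so that only
  iterates of one operator have to be controlled.\<close>

definition mf_kernel :: "real \<Rightarrow> (('v \<Rightarrow> nat) \<Rightarrow> real) \<Rightarrow> ('v \<Rightarrow> nat) \<Rightarrow> real" where
  "mf_kernel \<epsilon> g \<eta> = g \<eta> + \<epsilon> * mf_generator g \<eta>"

text \<open>
  The terms of \<open>split\<close> below are those of the coupling: no jump, common jumps of the particles of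
  \<open>\<zeta>\<close>, jumps of one extra particle alone. The extra particles also jump together, at rate \<open>\<Delta>\<close>; they
  then merge, so that this contributes nothing, and the remaining weights add up to \<open>1 - \<epsilon> \<Delta>\<close>.
\<close>

lemma mf_kernel_contraction:
  assumes lip: "particle_lipschitz k L g"
    and inc: "\<And>x j. \<Delta> \<le> r x (Suc j) - r x j"
    and \<epsilon>: "0 \<le> \<epsilon>"
    and small: "\<And>\<zeta> a b. \<zeta> \<in> zrp_states k \<Longrightarrow> \<epsilon> * ((\<Sum>x\<in>UNIV. r x (\<zeta> x)) +
       (r a (Suc (\<zeta> a)) - r a (\<zeta> a)) + (r b (Suc (\<zeta> b)) - r b (\<zeta> b)) - \<Delta>) \<le> 1"
  shows "particle_lipschitz k ((1 - \<epsilon> * \<Delta>) * L) (mf_kernel \<epsilon> g)"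
  unfolding particle_lipschitz_def
proof (intro ballI allI)
  fix \<zeta> :: "'v \<Rightarrow> nat" and a b assume \<zeta>: "\<zeta> \<in> zrp_states k"
  let ?n = "real CARD('v)"
  let ?\<eta> = "add_particle a \<zeta>" and ?\<xi> = "add_particle b \<zeta>"
  define A where "A = (\<Sum>y\<in>UNIV. g (add_particle y \<zeta>)) / ?n"
  define \<alpha> where "\<alpha> c = r c (Suc (\<zeta> c)) - r c (\<zeta> c)" for c
  define M where "M c x = (\<Sum>y\<in>UNIV. g (add_particle c (move_particle x y \<zeta>))) / ?n" for c x
  define D where "D = g ?\<eta> - g ?\<xi>"
  define R where "R = (\<Sum>x\<in>UNIV. r x (\<zeta> x))"
  define S where "S = (\<Sum>x\<in>UNIV. r x (\<zeta> x) * (M a x - M b x))"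
  \<comment> \<open>At site \<open>c\<close> the rate is split into the part due to \<zeta> and the
    surplus \<open>\<alpha> c\<close> caused by the extra particle. A jump at the surplus rate leads
    to the average \<open>A\<close>, whatever \<open>c\<close> is.\<close>
  have gen: "mf_generator g (add_particle c \<zeta>)
    = (\<Sum>x\<in>UNIV. r x (\<zeta> x) * M c x) - R * g (add_particle c \<zeta>) + \<alpha> c * (A - g (add_particle c \<zeta>))" for c
  proof -
    let ?h = "\<lambda>x. (\<Sum>y\<in>UNIV. g (move_particle x y (add_particle c \<zeta>))) / ?n - g (add_particle c \<zeta>)"
    have "mf_generator g (add_particle c \<zeta>)
      = (\<Sum>x\<in>UNIV. r x (\<zeta> x) * ?h x + (if x = c then \<alpha> c * ?h c else 0))"
      unfolding mf_generator_eq
      by (intro sum.cong refl) (simp add: add_particle_apply \<alpha>_def left_diff_distrib)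
    also have "\<dots> = (\<Sum>x\<in>UNIV. r x (\<zeta> x) * ?h x) + \<alpha> c * ?h c"
      by (simp add: sum.distrib)
    also have "?h c = A - g (add_particle c \<zeta>)"
      by (simp add: move_add_particle A_def)
    also have "(\<Sum>x\<in>UNIV. r x (\<zeta> x) * ?h x)
        = (\<Sum>x\<in>UNIV. r x (\<zeta> x) * M c x - r x (\<zeta> x) * g (add_particle c \<zeta>))"
    \<comment> \<open>At an empty site \<open>M c x\<close> need not describe a genuine jump, but
      its coefficient is zero.\<close>
    proof (intro sum.cong refl)
      fix x
      show "r x (\<zeta> x) * ?h x = r x (\<zeta> x) * M c x - r x (\<zeta> x) * g (add_particle c \<zeta>)"
        by (cases "\<zeta> x = 0")
          (simp_all add: rate_0 M_def move_particle_add_particle right_diff_distrib)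
    qed
    also have "\<dots> = (\<Sum>x\<in>UNIV. r x (\<zeta> x) * M c x) - R * g (add_particle c \<zeta>)"
      by (simp add: R_def sum_subtractf sum_distrib_right)
    finally show ?thesis by simp
  qed
  have average: "\<bar>(\<Sum>y\<in>UNIV. u y) / ?n\<bar> \<le> L" if "\<And>y. \<bar>u y\<bar> \<le> L" for u :: "'v \<Rightarrow> real"
  proof -
    have "\<bar>\<Sum>y\<in>UNIV. u y\<bar> \<le> (\<Sum>y::'v\<in>UNIV. L)"
      by (rule order_trans[OF sum_abs]) (intro sum_mono that)
    then show ?thesis by (simp add: field_simps)
  qed
  have bA: "\<bar>A - g (add_particle c \<zeta>)\<bar> \<le> L" for c
    using average[of "\<lambda>y. g (add_particle y \<zeta>) - g (add_particle c \<zeta>)"] particle_lipschitzD[OF lip \<zeta>]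
    by (simp add: A_def sum_subtractf diff_divide_distrib)
  have bM: "r x (\<zeta> x) * \<bar>M a x - M b x\<bar> \<le> r x (\<zeta> x) * L" for x
  proof (cases "\<zeta> x = 0")
    case False
    then have "move_particle x y \<zeta> \<in> zrp_states k" for y
      using \<zeta> by (intro move_particle_zrp_states) auto
    then have "\<bar>M a x - M b x\<bar> \<le> L"
      using average[of "\<lambda>y. g (add_particle a (move_particle x y \<zeta>)) - g (add_particle b (move_particle x y \<zeta>))"]
        particle_lipschitzD[OF lip]
      by (simp add: M_def sum_subtractf diff_divide_distrib)
    then show ?thesis by (intro mult_left_mono rate_nonneg)
  qed (simp add: rate_0)
  have bS: "\<bar>S\<bar> \<le> R * L"
  proof -
    have "\<bar>S\<bar> \<le> (\<Sum>x\<in>UNIV. \<bar>r x (\<zeta> x) * (M a x - M b x)\<bar>)" unfolding S_def by (rule sum_abs)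
    also have "\<dots> \<le> (\<Sum>x\<in>UNIV. r x (\<zeta> x) * L)"
      using bM rate_nonneg by (intro sum_mono) (simp add: abs_mult)
    finally show ?thesis by (simp add: R_def sum_distrib_right)
  qed
  \<comment> \<open>These are the weights of no jump and of a lone jump of the extra particle at
    \<open>a\<close> or at \<open>b\<close>. The step-size condition makes \<open>u\<close>
    nonnegative; the lower bound on the increments does so for \<open>v\<close> and
    \<open>w\<close>.\<close>
  define u v w where "u = 1 - \<epsilon> * (R + \<alpha> a + \<alpha> b - \<Delta>)" and "v = \<epsilon> * (\<alpha> a - \<Delta>)"
    and "w = \<epsilon> * (\<alpha> b - \<Delta>)"
  have uvw: "0 \<le> u" "0 \<le> v" "0 \<le> w"
    using small[OF \<zeta>, of a b] inc \<epsilon> by (auto simp: u_def v_def w_def R_def \<alpha>_def)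
  have split: "mf_kernel \<epsilon> g ?\<eta> - mf_kernel \<epsilon> g ?\<xi>
      = u * D + \<epsilon> * S + (v * (A - g ?\<xi>) - w * (A - g ?\<eta>))"
    unfolding mf_kernel_def gen S_def u_def v_def w_def D_def
    by (simp add: algebra_simps sum_subtractf)
  have "\<bar>u * D\<bar> \<le> u * L" "\<bar>v * (A - g ?\<xi>)\<bar> \<le> v * L" "\<bar>w * (A - g ?\<eta>)\<bar> \<le> w * L" "\<bar>\<epsilon> * S\<bar> \<le> \<epsilon> * (R * L)"
    using uvw \<epsilon> bA bS particle_lipschitzD[OF lip \<zeta>]
    by (auto simp: abs_mult D_def intro!: mult_left_mono)
  then have "\<bar>mf_kernel \<epsilon> g ?\<eta> - mf_kernel \<epsilon> g ?\<xi>\<bar> \<le> u * L + \<epsilon> * (R * L) + v * L + w * L"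
    unfolding split by linarith
  also have "\<dots> = (1 - \<epsilon> * \<Delta>) * L"
    by (simp add: u_def v_def w_def algebra_simps)
  finally show "\<bar>mf_kernel \<epsilon> g ?\<eta> - mf_kernel \<epsilon> g ?\<xi>\<bar> \<le> (1 - \<epsilon> * \<Delta>) * L" .
qed

text \<open>There are finitely many \<zeta>, \<open>a\<close> and \<open>b\<close>, so the rates
  involved are bounded. Requiring \<epsilon> * \<Delta> < 1 keeps the contraction factor
  positive.\<close>

lemma ex_step_size:
  assumes "0 < \<Delta>"
  obtains \<epsilon> where "0 < \<epsilon>" "\<epsilon> * \<Delta> < 1"
    "\<And>\<zeta> a b. \<zeta> \<in> zrp_states k \<Longrightarrow> \<epsilon> * ((\<Sum>x\<in>UNIV. r x (\<zeta> x)) +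
       (r a (Suc (\<zeta> a)) - r a (\<zeta> a)) + (r b (Suc (\<zeta> b)) - r b (\<zeta> b)) - \<Delta>) \<le> 1"
proof -
  define F where "F \<zeta> a b = (\<Sum>x\<in>UNIV. r x (\<zeta> x)) +
       (r a (Suc (\<zeta> a)) - r a (\<zeta> a)) + (r b (Suc (\<zeta> b)) - r b (\<zeta> b)) - \<Delta>" for \<zeta> a b
  define C where "C = (\<Sum>(\<zeta>, a, b)\<in>zrp_states k \<times> UNIV. \<bar>F \<zeta> a b\<bar>)"
  have F: "F \<zeta> a b \<le> C" if "\<zeta> \<in> zrp_states k" for \<zeta> a b
  proof -
    have "\<bar>F \<zeta> a b\<bar> \<le> C"
      unfolding C_def
      using member_le_sum[of "(\<zeta>, a, b)" "zrp_states k \<times> UNIV" "\<lambda>(\<zeta>, a, b). \<bar>F \<zeta> a b\<bar>"] that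
      by (auto simp: finite_zrp_states)
    then show ?thesis by simp
  qed
  have C: "0 \<le> C" by (auto simp: C_def intro!: sum_nonneg)
  show thesis
  proof
    show "0 < 1 / (1 + \<Delta> + C)" "1 / (1 + \<Delta> + C) * \<Delta> < 1"
      using assms C by (auto simp: field_simps)
    show "1 / (1 + \<Delta> + C) * ((\<Sum>x\<in>UNIV. r x (\<zeta> x)) +
       (r a (Suc (\<zeta> a)) - r a (\<zeta> a)) + (r b (Suc (\<zeta> b)) - r b (\<zeta> b)) - \<Delta>) \<le> 1"
      if "\<zeta> \<in> zrp_states k" for \<zeta> a b
      using F[OF that, of a b] C assms by (simp add: F_def field_simps)
  qed
qed

text \<open>Lipschitz contraction and zero mean make the iterates decay uniformly at rate
  \<open>q\<close>, hence also in mean square. Self-adjointness turns this into a bound on the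
  pairing of \<open>g\<close> with \<open>K g\<close>, from which \<epsilon> cancels exactly,
  without a limit of small steps.\<close>

lemma mf_poincare_centred:
  assumes \<Delta>: "0 < \<Delta>" and inc: "\<And>x j. \<Delta> \<le> r x (Suc j) - r x j"
    and centred: "(\<Sum>\<eta>\<in>zrp_states (Suc k). law (Suc k) \<eta> * g \<eta>) = 0"
  shows "\<Delta> * (\<Sum>\<eta>\<in>zrp_states (Suc k). law (Suc k) \<eta> * (g \<eta>)\<^sup>2)
    \<le> zrp_dirichlet_form mean_field r (Suc k) g g"
proof -
  let ?S = "zrp_states (Suc k) :: ('v \<Rightarrow> nat) set" and ?\<mu> = "law (Suc k)"
  obtain \<epsilon> where \<epsilon>: "0 < \<epsilon>" "\<epsilon> * \<Delta> < 1"
    and small: "\<And>\<zeta> a b. \<zeta> \<in> zrp_states k \<Longrightarrow> \<epsilon> * ((\<Sum>x\<in>UNIV. r x (\<zeta> x)) +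
       (r a (Suc (\<zeta> a)) - r a (\<zeta> a)) + (r b (Suc (\<zeta> b)) - r b (\<zeta> b)) - \<Delta>) \<le> 1"
    using ex_step_size[OF \<Delta>] by metis
  define K where "K = mf_kernel \<epsilon>"
  define q where "q = 1 - \<epsilon> * \<Delta>"
  obtain L where L: "particle_lipschitz k L g" by (rule particle_lipschitz_exists)
  have inner_K: "(\<Sum>\<eta>\<in>?S. ?\<mu> \<eta> * f \<eta> * K h \<eta>)
      = (\<Sum>\<eta>\<in>?S. ?\<mu> \<eta> * f \<eta> * h \<eta>) - \<epsilon> * zrp_dirichlet_form mean_field r (Suc k) f h" for f h
  proof -
    have "(\<Sum>\<eta>\<in>?S. ?\<mu> \<eta> * f \<eta> * K h \<eta>)
      = (\<Sum>\<eta>\<in>?S. ?\<mu> \<eta> * f \<eta> * h \<eta>) + \<epsilon> * (\<Sum>\<eta>\<in>?S. ?\<mu> \<eta> * f \<eta> * mf_generator h \<eta>)"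
      by (simp add: K_def mf_kernel_def algebra_simps sum.distrib sum_distrib_left)
    then show ?thesis by (simp add: mf_dirichlet_form)
  qed
  have lip_iter: "particle_lipschitz k (q ^ t * L) ((K ^^ t) g)" for t
  proof (induction t)
    case (Suc t)
    show ?case
      using mf_kernel_contraction[OF Suc inc _ small] \<epsilon> by (simp add: K_def q_def mult.assoc)
  qed (simp add: L)
  have centred_iter: "(\<Sum>\<eta>\<in>?S. ?\<mu> \<eta> * (K ^^ t) g \<eta>) = 0" for t
  proof (induction t)
    case (Suc t)
    have "(\<Sum>\<eta>\<in>?S. ?\<mu> \<eta> * K h \<eta>) = (\<Sum>\<eta>\<in>?S. ?\<mu> \<eta> * h \<eta>) + \<epsilon> * (\<Sum>\<eta>\<in>?S. ?\<mu> \<eta> * mf_generator h \<eta>)" for h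
      by (simp add: K_def mf_kernel_def algebra_simps sum.distrib sum_distrib_left)
    then show ?case using Suc by (simp add: expectation_mf_generator)
  qed (simp add: centred)
  have decay: "(\<Sum>\<eta>\<in>?S. ?\<mu> \<eta> * ((K ^^ t) g \<eta>)\<^sup>2) \<le> (real (Suc k) * L)\<^sup>2 * (q\<^sup>2) ^ t" for t
  proof -
    let ?h = "(K ^^ t) g" and ?B = "real (Suc k) * (q ^ t * L)"
    have pt: "(?h \<eta>)\<^sup>2 \<le> ?B\<^sup>2" if \<eta>: "\<eta> \<in> ?S" for \<eta>
    proof -
      \<comment> \<open>A centred function is at each point the average of its differences to the
        other values, so its oscillation bounds it.\<close>
      have "?h \<eta> = (\<Sum>\<xi>\<in>?S. ?\<mu> \<xi>) * ?h \<eta> - (\<Sum>\<xi>\<in>?S. ?\<mu> \<xi> * ?h \<xi>)"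
        by (simp add: sum_law centred_iter)
      also have "\<dots> = (\<Sum>\<xi>\<in>?S. ?\<mu> \<xi> * (?h \<eta> - ?h \<xi>))"
        by (simp add: sum_subtractf sum_distrib_right right_diff_distrib)
      finally have "\<bar>?h \<eta>\<bar> \<le> (\<Sum>\<xi>\<in>?S. \<bar>?\<mu> \<xi> * (?h \<eta> - ?h \<xi>)\<bar>)"
        using sum_abs[of "\<lambda>\<xi>. ?\<mu> \<xi> * (?h \<eta> - ?h \<xi>)" ?S] by simp
      also have "\<dots> \<le> (\<Sum>\<xi>\<in>?S. ?\<mu> \<xi> * ?B)"
      proof (intro sum_mono)
        fix \<xi> :: "'v \<Rightarrow> nat" assume "\<xi> \<in> ?S"
        then show "\<bar>?\<mu> \<xi> * (?h \<eta> - ?h \<xi>)\<bar> \<le> ?\<mu> \<xi> * ?B"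
          using particle_lipschitz_oscillation[OF lip_iter \<eta>, of \<xi>] law_nonneg
          by (simp only: abs_mult abs_of_nonneg mult_left_mono)
      qed
      also have "\<dots> = ?B" by (simp only: sum_distrib_right[symmetric] sum_law mult_1)
      finally show ?thesis by (rule abs_le_square_iff[THEN iffD1, OF order_trans]) (rule abs_ge_self)
    qed
    have "(\<Sum>\<eta>\<in>?S. ?\<mu> \<eta> * (?h \<eta>)\<^sup>2) \<le> (\<Sum>\<eta>\<in>?S. ?\<mu> \<eta> * ?B\<^sup>2)"
      by (intro sum_mono mult_left_mono pt law_nonneg)
    also have "\<dots> = ?B\<^sup>2" by (simp only: sum_distrib_right[symmetric] sum_law mult_1)
    also have "\<dots> = (real (Suc k) * L)\<^sup>2 * (q\<^sup>2) ^ t"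
      by (simp only: power_mult_distrib power_mult[symmetric] mult.commute mult.left_commute)
    finally show ?thesis .
  qed
  have sym: "(\<Sum>\<eta>\<in>?S. ?\<mu> \<eta> * f \<eta> * K h \<eta>) = (\<Sum>\<eta>\<in>?S. ?\<mu> \<eta> * h \<eta> * K f \<eta>)" for f h
    unfolding inner_K using mf_dirichlet_form_commute[of k f h] by (simp add: mult_ac)
  have "(\<Sum>\<eta>\<in>?S. ?\<mu> \<eta> * g \<eta> * K g \<eta>) \<le> q * (\<Sum>\<eta>\<in>?S. ?\<mu> \<eta> * (g \<eta>)\<^sup>2)"
    by (rule selfadjoint_rayleigh_le[OF law_nonneg sym decay]) (use \<epsilon> in \<open>simp add: q_def\<close>)
  moreover have "(\<Sum>\<eta>\<in>?S. ?\<mu> \<eta> * g \<eta> * g \<eta>) = (\<Sum>\<eta>\<in>?S. ?\<mu> \<eta> * (g \<eta>)\<^sup>2)"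
    by (simp add: power2_eq_square mult.assoc)
  ultimately have "\<epsilon> * (\<Delta> * (\<Sum>\<eta>\<in>?S. ?\<mu> \<eta> * (g \<eta>)\<^sup>2))
      \<le> \<epsilon> * zrp_dirichlet_form mean_field r (Suc k) g g"
    unfolding inner_K q_def by (simp add: left_diff_distrib mult.assoc)
  then show ?thesis using \<epsilon> by simp
qed

lemma mf_poincare:
  assumes "0 < \<Delta>" "\<And>x j. \<Delta> \<le> r x (Suc j) - r x j"
  shows "\<Delta> * variance_on (zrp_states (Suc k)) (law (Suc k)) f
    \<le> zrp_dirichlet_form mean_field r (Suc k) f f"
proof -
  let ?S = "zrp_states (Suc k) :: ('v \<Rightarrow> nat) set" and ?\<mu> = "law (Suc k)"
  define e where "e = expectation_on ?S ?\<mu> f"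
  define g where "g \<eta> = f \<eta> - e" for \<eta>
  have "(\<Sum>\<eta>\<in>?S. ?\<mu> \<eta> * g \<eta>) = e - (\<Sum>\<eta>\<in>?S. ?\<mu> \<eta>) * e"
    by (simp add: g_def e_def expectation_on_def right_diff_distrib sum_subtractf sum_distrib_right)
  then have "(\<Sum>\<eta>\<in>?S. ?\<mu> \<eta> * g \<eta>) = 0" by (simp add: sum_law)
  moreover have "variance_on ?S ?\<mu> f = (\<Sum>\<eta>\<in>?S. ?\<mu> \<eta> * (g \<eta>)\<^sup>2)"
    by (simp add: variance_on_def expectation_on_def g_def e_def)
  ultimately have "\<Delta> * variance_on ?S ?\<mu> f \<le> zrp_dirichlet_form mean_field r (Suc k) g g"
    using mf_poincare_centred[OF assms, of k g] by simp
  also have "\<dots> = zrp_dirichlet_form mean_field r (Suc k) f f"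
  proof -
    \<comment> \<open>The constant \<open>e\<close> drops out of the generator; stationarity removes
      it from the left factor.\<close>
    have "mf_generator g = mf_generator f"
      by (simp add: fun_eq_iff zrp_generator_def g_def)
    then have "(\<Sum>\<eta>\<in>?S. ?\<mu> \<eta> * g \<eta> * mf_generator g \<eta>)
      = (\<Sum>\<eta>\<in>?S. ?\<mu> \<eta> * f \<eta> * mf_generator f \<eta>) - e * (\<Sum>\<eta>\<in>?S. ?\<mu> \<eta> * mf_generator f \<eta>)"
      by (simp add: g_def algebra_simps sum_subtractf sum_distrib_left)
    then show ?thesis by (simp add: expectation_mf_generator mf_dirichlet_form)
  qed
  finally show ?thesis .
qed

lemma variance_pos:
  assumes "\<not> f constant_on zrp_states m"
  shows "0 < variance_on (zrp_states m) (law m) f"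
proof -
  let ?e = "expectation_on (zrp_states m) (law m) f"
  obtain \<eta> where \<eta>: "\<eta> \<in> zrp_states m" "f \<eta> \<noteq> ?e"
    using assms by (auto simp: constant_on_def)
  have "0 < law m \<eta> * (f \<eta> - ?e)\<^sup>2"
    using \<eta> weight_pos sum_weight_pos by (simp add: law_def)
  then show ?thesis
    unfolding variance_on_def expectation_on_def[of _ _ "\<lambda>s. (f s - ?e)\<^sup>2"]
    using \<eta> by (intro sum_pos2[OF finite_zrp_states]) (auto simp: law_nonneg)
qed

end

section \<open>The bound for a general matrix\<close>

lemma ex_not_constant_on_zrp_states:
  assumes "2 \<le> CARD('v::finite)" "1 \<le> m"
  shows "\<exists>f :: ('v \<Rightarrow> nat) \<Rightarrow> real. \<not> f constant_on zrp_states m"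
proof -
  obtain a b :: 'v where "a \<noteq> b"
    using assms(1) card_le_Suc0_iff_eq[of "UNIV :: 'v set"] by force
  define \<delta> :: "'v \<Rightarrow> 'v \<Rightarrow> nat" where "\<delta> x z = (if z = x then m else 0)" for x z
  have "\<delta> x \<in> zrp_states m" for x by (simp add: zrp_states_def \<delta>_def)
  moreover have "real (\<delta> a a) \<noteq> real (\<delta> b a)" using \<open>a \<noteq> b\<close> assms(2) by (simp add: \<delta>_def)
  ultimately have "\<not> (\<lambda>\<eta>. real (\<eta> a)) constant_on zrp_states m"
    unfolding constant_on_def by metis
  then show ?thesis by blast
qed

text \<open>The increments of the rates may be unbounded below, so the infimum is taken in the
  extended reals.\<close>

theorem corollary4:
  fixes P :: "real^'v^'v" and r :: "'v::finite \<Rightarrow> nat \<Rightarrow> real" and m :: nat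
  assumes "CARD('v) \<ge> 2"
    and "m \<ge> 1"
    and "\<And>x k. k \<ge> 1 \<Longrightarrow> r x k > 0"
    and "\<And>x. r x 0 = 0"
    and "irreducible_matrix P"
    and "doubly_stochastic P"
  shows "ereal (poincare_zrp P r m)
    \<ge> ereal (poincare_matrix P) * (INF (x, k)\<in>UNIV. ereal (r x (k + 1) - r x k))"
proof -
  interpret zrp_rates r using assms by unfold_locales auto
  note P = assms(6,5)
  obtain k where m: "m = Suc k" using assms(2) by (cases m) auto
  define I where "I = (INF (x, k)\<in>UNIV. ereal (r x (k + 1) - r x k))"
  \<comment> \<open>A non-constant observable is needed for the infimum defining
    \<open>poincare_zrp\<close> to range over a nonempty set.\<close>
  obtain f0 :: "('v \<Rightarrow> nat) \<Rightarrow> real" where f0: "\<not> f0 constant_on zrp_states m"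
    using ex_not_constant_on_zrp_states[OF assms(1,2)] by blast
  have zrp_nonneg: "0 \<le> poincare_zrp P r m"
    unfolding poincare_zrp_def zrp_law_eq[OF P]
    using f0 law_nonneg zrp_dirichlet_form_nonneg[OF P] m
    by (intro poincare_constant_nonneg) auto
  obtain a b :: 'v where "a \<noteq> b"
    using assms(1) card_le_Suc0_iff_eq[of "UNIV :: 'v set"] by force
  then have "\<not> (\<lambda>x. of_bool (x = a) :: real) constant_on UNIV"
    unfolding constant_on_def by (metis UNIV_I of_bool_eq(1,2) zero_neq_one)
  then have P_nonneg: "0 \<le> poincare_matrix P"
    unfolding poincare_matrix_def
    by (intro poincare_constant_nonneg dirichlet_form_nonneg[OF P]) (auto simp: invariant_law_uniform[OF P])
  have I_le: "I \<le> ereal (r x (Suc j) - r x j)" for x j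
    unfolding I_def by (rule INF_lower2[of "(x, j)"]) auto
  have "ereal (poincare_matrix P) * I \<le> ereal (poincare_zrp P r m)"
  proof (cases "0 < I")
    \<comment> \<open>For a nonpositive infimum, possibly minus infinity, the signs of the two
      Poincare constants suffice.\<close>
    case False
    then have "ereal (poincare_matrix P) * I \<le> 0"
      using P_nonneg by (simp add: ereal_mult_le_0_iff not_less)
    then show ?thesis using zrp_nonneg by (meson ereal_less_eq(5) order_trans)
  next
    case True
    \<comment> \<open>A positive infimum is finite, being at most the increment at some site and
      \<open>j = 0\<close>.\<close>
    then obtain \<Delta> where \<Delta>: "I = ereal \<Delta>" using I_le[of undefined 0] by (cases I) auto
    have "poincare_matrix P * \<Delta> \<le> poincare_zrp P r m"
      unfolding poincare_zrp_def poincare_constant_def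
    proof (rule cInf_greatest)
      fix q assume "q \<in> {zrp_dirichlet_form P r m f f / variance_on (zrp_states m) (zrp_law P r m) f |f.
        \<not> f constant_on zrp_states m}"
      then obtain f where f: "\<not> f constant_on zrp_states m"
        and q: "q = zrp_dirichlet_form P r m f f / variance_on (zrp_states m) (law m) f"
        by (auto simp: zrp_law_eq[OF P])
      have "\<Delta> * variance_on (zrp_states m) (law m) f \<le> zrp_dirichlet_form mean_field r m f f"
        unfolding m using True I_le by (intro mf_poincare) (auto simp: \<Delta>)
      then have "poincare_matrix P * (\<Delta> * variance_on (zrp_states m) (law m) f)
          \<le> poincare_matrix P * zrp_dirichlet_form mean_field r m f f"
        using P_nonneg by (rule mult_left_mono)
      also have "\<dots> \<le> zrp_dirichlet_form P r m f f"
        unfolding m by (rule zrp_dirichlet_form_comparison[OF P])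
      finally show "poincare_matrix P * \<Delta> \<le> q"
        using variance_pos[OF f] by (simp add: q field_simps)
    qed (use f0 in blast)
    then show ?thesis by (simp add: \<Delta>)
  qed
  then show ?thesis by (simp add: I_def)
qed

end
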